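(* Let $\mathcal H$ be a complete frame expanding the first-order $\Sigma$-structure $\mathcal A$. For every $(\mathcal A,\mathcal H)$-unsatisfiable (possibly infinite) set $\Gamma$ of HoCHCs there exists a finite subset $\Gamma'\subseteq\Gamma$ which is $(\mathcal A,\mathcal H)$-unsatisfiable.
   Context: Types. Fix a base type $\iota$. Argument types $\tau::=\iota\mid\rho$; relational types $\rho::=o\mid\tau\to\rho$; first-order types $\sigma_{FO}::=\iota\mid\iota\to o\mid\iota\to\sigma_{FO}$; types $\sigma::=\rho\mid\sigma_{FO}$. A fixed type environment $\Delta$ maps variables to argument types, $\Delta^{-1}(\tau)$ infinite for each $\tau$. Signatures are sets of typed symbols distinct from variables and the logical symbols $\neg,\land,\lor,\exists_\tau$. Terms: $M::=x\mid c\mid\neg\mid\land\mid\lor\mid\exists_\tau\mid MM\mid\lambda x.M$, simply typed ($\lambda x.M:\Delta(x)\to\rho$ only for $M$ of relational type $\rho$; $\land,\lor:o\to o\to o$; $\neg M:o$ for $M:o$; $\exists_\tau:(\tau\to o)\to o$). Formulas have type $o$. First-order $\Sigma$-formulas use only first-order-typed symbols, variables of type $\iota$, no $\lambda$. Positive existential: no $\neg$. Semantics: a pre-frame $\mathcal H$ gives nonempty sets $\mathcal H[\![\sigma]\!]$, $\mathcal H[\![o]\!]=\{0,1\}$, function types interpreted by sets of functions, containing $\min,\max$ on $\{0,1\}$ and $E_\tau(r)=\max_{s\in\mathcal H[\![\tau]\!]}r(s)$. Denotation of terms in a $(\Sigma,\mathcal H)$-structure $\mathcal B$ under valuation $\alpha$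 is standard; a frame is a pre-frame in which every positive existential $\lambda x.M$ denotes $r\mapsto[\![M]\!]^{\mathcal B}(\alpha[x\mapsto r])$. $\mathcal B\models F$ iff $F$ has value $1$ under all valuations. Order $\sqsubseteq$: equality on $\iota$, $\le$ on $o$, pointwise on functions; a frame is complete if each $\mathcal H[\![\rho]\!]$ ($\rho$ relational) is closed under pointwise least upper bounds of arbitrary subsets. Background: fixed first-order signature $\Sigma$, first-order $\Sigma$-structure $\mathcal A$, and $\Sigma'\supseteq\Sigma$ adding only relational-typed symbols. $\mathcal H$ expands $\mathcal A$ if $\mathcal H[\![\iota]\!]=\mathcal A[\![\iota]\!]$ and $c^{\mathcal A}\in\mathcal H[\![\sigma]\!]$ for all $c:\sigma\in\Sigma$; a $(\Sigma',\mathcal H)$-expansion of $\mathcal A$ agrees with $\mathcal A$ on $\Sigma$. Clauses: an atom is a $\Sigma'$-formula without logical symbols. Goal clause: $\neg A_1\lor\cdots\lor\neg A_n$; definite clause: $G\lor R\,x_1\cdots x_n$ with $G$ a goal clause, $R\in\Sigma'\setminus\Sigma$, $x_i$ distinct variables; HoCHC: goal or definite clause, free variables universally quantified. $\Gamma$ is $(\mathcal A,\mathcal H)$-satisfiable if some $(\Sigma',\mathcal H)$-expansion of $\mathcal A$ satisfies all clauses in $\Gamma$. *)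

theory Defs
  imports Main
begin

datatype ty = Iota ("\<iota>") | Prop ("\<o>") | Arrow ty ty (infixr "\<^bold>\<rightarrow>" 60)

inductive arg_type :: "ty \<Rightarrow> bool" and rel_type :: "ty \<Rightarrow> bool" where
  "arg_type \<iota>"
| "rel_type \<rho> \<Longrightarrow> arg_type \<rho>"
| "rel_type \<o>"
| "arg_type \<tau> \<Longrightarrow> rel_type \<rho> \<Longrightarrow> rel_type (\<tau> \<^bold>\<rightarrow> \<rho>)"

inductive fo_type :: "ty \<Rightarrow> bool" where
  "fo_type \<iota>"
| "fo_type (\<iota> \<^bold>\<rightarrow> \<o>)"
| "fo_type \<sigma> \<Longrightarrow> fo_type (\<iota> \<^bold>\<rightarrow> \<sigma>)"

definition is_type :: "ty \<Rightarrow> bool" where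
  "is_type \<sigma> \<longleftrightarrow> rel_type \<sigma> \<or> fo_type \<sigma>"

definition type_env :: "('v \<Rightarrow> ty) \<Rightarrow> bool" where
  "type_env \<Delta> \<longleftrightarrow> (\<forall>x. arg_type (\<Delta> x)) \<and> (\<forall>\<tau>. arg_type \<tau> \<longrightarrow> infinite {x. \<Delta> x = \<tau>})"

text \<open>A signature is a partial map, so that every symbol has at most one type.\<close>

definition signature :: "('c \<rightharpoonup> ty) \<Rightarrow> bool" where
  "signature \<Sigma> \<longleftrightarrow> (\<forall>c \<sigma>. \<Sigma> c = Some \<sigma> \<longrightarrow> is_type \<sigma>)"

definition fo_signature :: "('c \<rightharpoonup> ty) \<Rightarrow> bool" where
  "fo_signature \<Sigma> \<longleftrightarrow> (\<forall>c \<sigma>. \<Sigma> c = Some \<sigma> \<longrightarrow> fo_type \<sigma>)"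

definition relational_extension :: "('c \<rightharpoonup> ty) \<Rightarrow> ('c \<rightharpoonup> ty) \<Rightarrow> bool" where
  "relational_extension \<Sigma> \<Sigma>' \<longleftrightarrow>
     \<Sigma> \<subseteq>\<^sub>m \<Sigma>' \<and> (\<forall>c \<rho>. \<Sigma>' c = Some \<rho> \<and> \<Sigma> c = None \<longrightarrow> rel_type \<rho>)"

text \<open>Negation is a unary constructor because the only typing rule for it is the one for
  \<open>\<not>M\<close> with \<open>M : o\<close>: unapplied, the symbol has no type.\<close>

datatype ('v, 'c) tm =
    Var 'v
  | Sym 'c
  | Neg "('v, 'c) tm"
  | And
  | Or
  | Ex ty
  | App "('v, 'c) tm" "('v, 'c) tm"
  | Lam 'v "('v, 'c) tm"

inductive typing :: "('v \<Rightarrow> ty) \<Rightarrow> ('c \<rightharpoonup> ty) \<Rightarrow> ('v, 'c) tm \<Rightarrow> ty \<Rightarrow> bool"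
  for \<Delta> :: "'v \<Rightarrow> ty" and \<Sigma> :: "'c \<rightharpoonup> ty" where
  "typing \<Delta> \<Sigma> (Var x) (\<Delta> x)"
| "\<Sigma> c = Some \<sigma> \<Longrightarrow> typing \<Delta> \<Sigma> (Sym c) \<sigma>"
| "typing \<Delta> \<Sigma> M \<o> \<Longrightarrow> typing \<Delta> \<Sigma> (Neg M) \<o>"
| "typing \<Delta> \<Sigma> And (\<o> \<^bold>\<rightarrow> \<o> \<^bold>\<rightarrow> \<o>)"
| "typing \<Delta> \<Sigma> Or (\<o> \<^bold>\<rightarrow> \<o> \<^bold>\<rightarrow> \<o>)"
| "arg_type \<tau> \<Longrightarrow> typing \<Delta> \<Sigma> (Ex \<tau>) ((\<tau> \<^bold>\<rightarrow> \<o>) \<^bold>\<rightarrow> \<o>)"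
| "typing \<Delta> \<Sigma> M (\<sigma> \<^bold>\<rightarrow> \<sigma>') \<Longrightarrow> typing \<Delta> \<Sigma> N \<sigma> \<Longrightarrow> typing \<Delta> \<Sigma> (App M N) \<sigma>'"
| "typing \<Delta> \<Sigma> M \<rho> \<Longrightarrow> rel_type \<rho> \<Longrightarrow> typing \<Delta> \<Sigma> (Lam x M) (\<Delta> x \<^bold>\<rightarrow> \<rho>)"

lemma typing_unique:
  assumes "typing \<Delta> \<Sigma> M \<sigma>" and "typing \<Delta> \<Sigma> M \<sigma>'"
  shows "\<sigma> = \<sigma>'"
  using assms
proof (induction arbitrary: \<sigma>' rule: typing.induct)
  case (7 M \<sigma>1 \<sigma>2 N)
  from "7.prems" obtain \<sigma>3 where "typing \<Delta> \<Sigma> M (\<sigma>3 \<^bold>\<rightarrow> \<sigma>')"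
    by (auto elim: typing.cases)
  then show ?case using "7.IH"(1) by blast
next
  case (8 M \<rho> x)
  from "8.prems" obtain \<rho>' where "\<sigma>' = \<Delta> x \<^bold>\<rightarrow> \<rho>'" "typing \<Delta> \<Sigma> M \<rho>'"
    by (auto elim: typing.cases)
  then show ?case using "8.IH" by blast
qed (auto elim: typing.cases)

primrec positive_existential :: "('v, 'c) tm \<Rightarrow> bool" where
  "positive_existential (Var x) = True"
| "positive_existential (Sym c) = True"
| "positive_existential (Neg M) = False"
| "positive_existential And = True"
| "positive_existential Or = True"
| "positive_existential (Ex \<tau>) = True"
| "positive_existential (App M N) = (positive_existential M \<and> positive_existential N)"
| "positive_existential (Lam x M) = positive_existential M"

primrec no_logical_symbol :: "('v, 'c) tm \<Rightarrow> bool" where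
  "no_logical_symbol (Var x) = True"
| "no_logical_symbol (Sym c) = True"
| "no_logical_symbol (Neg M) = False"
| "no_logical_symbol And = False"
| "no_logical_symbol Or = False"
| "no_logical_symbol (Ex \<tau>) = False"
| "no_logical_symbol (App M N) = (no_logical_symbol M \<and> no_logical_symbol N)"
| "no_logical_symbol (Lam x M) = no_logical_symbol M"

text \<open>HOL has no single type containing individuals, truth values and all functions over them.
  An element of a function domain is therefore an element \<open>f\<close> of an arbitrary type \<open>'f\<close> that stands
  for the function \<open>ap f\<close>. The definition of pre-frames below demands extensionality at every
  function type, so that the elements of that domain are in bijection with a set of functions from
  the argument domain to the result domain.\<close>

datatype ('i, 'f) val = Ind 'i | Bool bool | Fn 'f

record ('i, 'f) preframe =
  inds :: "'i set"
  funs :: "ty \<Rightarrow> ty \<Rightarrow> 'f set"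
  ap :: "'f \<Rightarrow> ('i, 'f) val \<Rightarrow> ('i, 'f) val"

fun domain_of :: "('i, 'f) preframe \<Rightarrow> ty \<Rightarrow> ('i, 'f) val set" where
  "domain_of H \<iota> = Ind ` inds H"
| "domain_of H \<o> = range Bool"
| "domain_of H (\<sigma> \<^bold>\<rightarrow> \<sigma>') = Fn ` funs H \<sigma> \<sigma>'"

fun vapp :: "('i, 'f) preframe \<Rightarrow> ('i, 'f) val \<Rightarrow> ('i, 'f) val \<Rightarrow> ('i, 'f) val" where
  "vapp H (Fn f) a = ap H f a"
| "vapp H _ a = undefined"

definition is_true :: "('i, 'f) val \<Rightarrow> bool" where
  "is_true v \<longleftrightarrow> v = Bool True"

definition is_min :: "('i, 'f) preframe \<Rightarrow> ('i, 'f) val \<Rightarrow> bool" where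
  "is_min H f \<longleftrightarrow> f \<in> domain_of H (\<o> \<^bold>\<rightarrow> \<o> \<^bold>\<rightarrow> \<o>) \<and>
     (\<forall>a b. vapp H (vapp H f (Bool a)) (Bool b) = Bool (a \<and> b))"

definition is_max :: "('i, 'f) preframe \<Rightarrow> ('i, 'f) val \<Rightarrow> bool" where
  "is_max H f \<longleftrightarrow> f \<in> domain_of H (\<o> \<^bold>\<rightarrow> \<o> \<^bold>\<rightarrow> \<o>) \<and>
     (\<forall>a b. vapp H (vapp H f (Bool a)) (Bool b) = Bool (a \<or> b))"

definition is_exists :: "('i, 'f) preframe \<Rightarrow> ty \<Rightarrow> ('i, 'f) val \<Rightarrow> bool" where
  "is_exists H \<tau> f \<longleftrightarrow> f \<in> domain_of H ((\<tau> \<^bold>\<rightarrow> \<o>) \<^bold>\<rightarrow> \<o>) \<and>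
     (\<forall>r\<in>domain_of H (\<tau> \<^bold>\<rightarrow> \<o>). vapp H f r = Bool (\<exists>s\<in>domain_of H \<tau>. is_true (vapp H r s)))"

definition pre_frame :: "('i, 'f) preframe \<Rightarrow> bool" where
  "pre_frame H \<longleftrightarrow>
     (\<forall>\<sigma>. is_type \<sigma> \<longrightarrow> domain_of H \<sigma> \<noteq> {}) \<and>
     (\<forall>\<sigma> \<sigma>'. is_type (\<sigma> \<^bold>\<rightarrow> \<sigma>') \<longrightarrow>
        (\<forall>f\<in>domain_of H (\<sigma> \<^bold>\<rightarrow> \<sigma>'). \<forall>a\<in>domain_of H \<sigma>. vapp H f a \<in> domain_of H \<sigma>') \<and>
        (\<forall>f\<in>domain_of H (\<sigma> \<^bold>\<rightarrow> \<sigma>'). \<forall>g\<in>domain_of H (\<sigma> \<^bold>\<rightarrow> \<sigma>').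
           (\<forall>a\<in>domain_of H \<sigma>. vapp H f a = vapp H g a) \<longrightarrow> f = g)) \<and>
     (\<exists>f. is_min H f) \<and> (\<exists>f. is_max H f) \<and> (\<forall>\<tau>. arg_type \<tau> \<longrightarrow> (\<exists>f. is_exists H \<tau> f))"

definition "structure" :: "('c \<rightharpoonup> ty) \<Rightarrow> ('i, 'f) preframe \<Rightarrow> ('c \<Rightarrow> ('i, 'f) val) \<Rightarrow> bool" where
  "structure \<Sigma> H B \<longleftrightarrow> (\<forall>c \<sigma>. \<Sigma> c = Some \<sigma> \<longrightarrow> B c \<in> domain_of H \<sigma>)"

definition valuation :: "('v \<Rightarrow> ty) \<Rightarrow> ('i, 'f) preframe \<Rightarrow> ('v \<Rightarrow> ('i, 'f) val) \<Rightarrow> bool" where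
  "valuation \<Delta> H \<alpha> \<longleftrightarrow> (\<forall>x. \<alpha> x \<in> domain_of H (\<Delta> x))"

text \<open>The denotation of an abstraction is the element of the function domain standing for
  \<open>r \<mapsto> \<lbrakk>M\<rbrakk>(\<alpha>[x \<mapsto> r])\<close>; it is unspecified when the domain lacks that function.\<close>

primrec den :: "('v \<Rightarrow> ty) \<Rightarrow> ('c \<rightharpoonup> ty) \<Rightarrow> ('i, 'f) preframe \<Rightarrow> ('c \<Rightarrow> ('i, 'f) val) \<Rightarrow>
    ('v, 'c) tm \<Rightarrow> ('v \<Rightarrow> ('i, 'f) val) \<Rightarrow> ('i, 'f) val" where
  "den \<Delta> \<Sigma> H B (Var x) = (\<lambda>\<alpha>. \<alpha> x)"
| "den \<Delta> \<Sigma> H B (Sym c) = (\<lambda>\<alpha>. B c)"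
| "den \<Delta> \<Sigma> H B (Neg M) = (\<lambda>\<alpha>. Bool (\<not> is_true (den \<Delta> \<Sigma> H B M \<alpha>)))"
| "den \<Delta> \<Sigma> H B And = (\<lambda>\<alpha>. THE f. is_min H f)"
| "den \<Delta> \<Sigma> H B Or = (\<lambda>\<alpha>. THE f. is_max H f)"
| "den \<Delta> \<Sigma> H B (Ex \<tau>) = (\<lambda>\<alpha>. THE f. is_exists H \<tau> f)"
| "den \<Delta> \<Sigma> H B (App M N) = (\<lambda>\<alpha>. vapp H (den \<Delta> \<Sigma> H B M \<alpha>) (den \<Delta> \<Sigma> H B N \<alpha>))"
| "den \<Delta> \<Sigma> H B (Lam x M) = (\<lambda>\<alpha>. THE f. \<exists>\<rho>. typing \<Delta> \<Sigma> M \<rho> \<and>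
     f \<in> domain_of H (\<Delta> x \<^bold>\<rightarrow> \<rho>) \<and>
     (\<forall>r\<in>domain_of H (\<Delta> x). vapp H f r = den \<Delta> \<Sigma> H B M (\<alpha>(x := r))))"

text \<open>Comprehension ranges over all signatures whose symbols are drawn from \<open>'c\<close>; as \<open>'c\<close> does not
  occur in the type of \<open>H\<close>, it is passed as an explicit type argument.\<close>

definition frame :: "'c itself \<Rightarrow> ('v \<Rightarrow> ty) \<Rightarrow> ('i, 'f) preframe \<Rightarrow> bool" where
  "frame _ \<Delta> H \<longleftrightarrow> pre_frame H \<and>
     (\<forall>(\<Sigma> :: 'c \<rightharpoonup> ty) B \<alpha> x M \<rho>.
        signature \<Sigma> \<and> structure \<Sigma> H B \<and> valuation \<Delta> H \<alpha> \<and>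
        positive_existential (Lam x M) \<and> typing \<Delta> \<Sigma> (Lam x M) (\<Delta> x \<^bold>\<rightarrow> \<rho>) \<longrightarrow>
        den \<Delta> \<Sigma> H B (Lam x M) \<alpha> \<in> domain_of H (\<Delta> x \<^bold>\<rightarrow> \<rho>) \<and>
        (\<forall>r\<in>domain_of H (\<Delta> x).
           vapp H (den \<Delta> \<Sigma> H B (Lam x M) \<alpha>) r = den \<Delta> \<Sigma> H B M (\<alpha>(x := r))))"

text \<open>\<open>is_lub H \<rho> S u\<close>: \<open>u\<close> is the pointwise least upper bound of \<open>S\<close>. On truth values this is
  the supremum for \<open>False < True\<close>. The notion is used at relational types only.\<close>

fun is_lub :: "('i, 'f) preframe \<Rightarrow> ty \<Rightarrow> ('i, 'f) val set \<Rightarrow> ('i, 'f) val \<Rightarrow> bool" where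
  "is_lub H \<iota> S u \<longleftrightarrow> False"
| "is_lub H \<o> S u \<longleftrightarrow> u = Bool (Sup {b. Bool b \<in> S})"
| "is_lub H (\<tau> \<^bold>\<rightarrow> \<rho>) S u \<longleftrightarrow>
     (\<forall>a\<in>domain_of H \<tau>. is_lub H \<rho> ((\<lambda>f. vapp H f a) ` S) (vapp H u a))"

definition complete_preframe :: "('i, 'f) preframe \<Rightarrow> bool" where
  "complete_preframe H \<longleftrightarrow>
     (\<forall>\<rho> S. rel_type \<rho> \<and> S \<subseteq> domain_of H \<rho> \<longrightarrow> (\<exists>u\<in>domain_of H \<rho>. is_lub H \<rho> S u))"

text \<open>First-order structures have genuine functions and relations on argument lists; \<open>func A c\<close>
  matters for \<open>c : \<iota>\<^sup>n \<rightarrow> \<iota>\<close> and \<open>pred A c\<close> for \<open>c : \<iota>\<^sup>n \<rightarrow> o\<close>, on lists of length \<open>n\<close>.\<close>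

record ('c, 'i) fo_struct =
  carrier :: "'i set"
  func :: "'c \<Rightarrow> 'i list \<Rightarrow> 'i"
  pred :: "'c \<Rightarrow> 'i list \<Rightarrow> bool"

primrec iotas :: "nat \<Rightarrow> ty \<Rightarrow> ty" where
  "iotas 0 \<beta> = \<beta>"
| "iotas (Suc n) \<beta> = \<iota> \<^bold>\<rightarrow> iotas n \<beta>"

definition fo_structure :: "('c \<rightharpoonup> ty) \<Rightarrow> ('c, 'i) fo_struct \<Rightarrow> bool" where
  "fo_structure \<Sigma> A \<longleftrightarrow> carrier A \<noteq> {} \<and>
     (\<forall>c as. \<Sigma> c = Some (iotas (length as) \<iota>) \<and> set as \<subseteq> carrier A \<longrightarrow> func A c as \<in> carrier A)"

text \<open>\<open>represents H A c \<sigma> v\<close>: the element \<open>v\<close> of the domain of \<open>\<sigma>\<close> is the (curried)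
  interpretation of \<open>c\<close> in \<open>A\<close>.\<close>

definition represents ::
    "('i, 'f) preframe \<Rightarrow> ('c, 'i) fo_struct \<Rightarrow> 'c \<Rightarrow> ty \<Rightarrow> ('i, 'f) val \<Rightarrow> bool" where
  "represents H A c \<sigma> v \<longleftrightarrow> v \<in> domain_of H \<sigma> \<and>
     (\<forall>as. set as \<subseteq> carrier A \<longrightarrow>
        (\<sigma> = iotas (length as) \<iota> \<longrightarrow> foldl (vapp H) v (map Ind as) = Ind (func A c as)) \<and>
        (\<sigma> = iotas (length as) \<o> \<longrightarrow> foldl (vapp H) v (map Ind as) = Bool (pred A c as)))"

definition expands :: "('c \<rightharpoonup> ty) \<Rightarrow> ('c, 'i) fo_struct \<Rightarrow> ('i, 'f) preframe \<Rightarrow> bool" where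
  "expands \<Sigma> A H \<longleftrightarrow> inds H = carrier A \<and>
     (\<forall>c \<sigma>. \<Sigma> c = Some \<sigma> \<longrightarrow> (\<exists>v. represents H A c \<sigma> v))"

definition expansion :: "('c \<rightharpoonup> ty) \<Rightarrow> ('c \<rightharpoonup> ty) \<Rightarrow> ('c, 'i) fo_struct \<Rightarrow>
    ('i, 'f) preframe \<Rightarrow> ('c \<Rightarrow> ('i, 'f) val) \<Rightarrow> bool" where
  "expansion \<Sigma> \<Sigma>' A H B \<longleftrightarrow> structure \<Sigma>' H B \<and>
     (\<forall>c \<sigma>. \<Sigma> c = Some \<sigma> \<longrightarrow> represents H A c \<sigma> (B c))"

text \<open>A clause is the list of its literals, read disjunctively. The empty list is the empty
  (unsatisfiable) goal clause, for which the term language has no formula.\<close>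

type_synonym ('v, 'c) clause = "('v, 'c) tm list"

definition atom :: "('v \<Rightarrow> ty) \<Rightarrow> ('c \<rightharpoonup> ty) \<Rightarrow> ('v, 'c) tm \<Rightarrow> bool" where
  "atom \<Delta> \<Sigma>' M \<longleftrightarrow> typing \<Delta> \<Sigma>' M \<o> \<and> no_logical_symbol M"

definition goal_clause :: "('v \<Rightarrow> ty) \<Rightarrow> ('c \<rightharpoonup> ty) \<Rightarrow> ('v, 'c) clause \<Rightarrow> bool" where
  "goal_clause \<Delta> \<Sigma>' C \<longleftrightarrow> (\<exists>As. (\<forall>M\<in>set As. atom \<Delta> \<Sigma>' M) \<and> C = map Neg As)"

definition definite_clause ::
    "('v \<Rightarrow> ty) \<Rightarrow> ('c \<rightharpoonup> ty) \<Rightarrow> ('c \<rightharpoonup> ty) \<Rightarrow> ('v, 'c) clause \<Rightarrow> bool" where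
  "definite_clause \<Delta> \<Sigma> \<Sigma>' C \<longleftrightarrow>
     (\<exists>G R xs. goal_clause \<Delta> \<Sigma>' G \<and> R \<in> dom \<Sigma>' - dom \<Sigma> \<and> distinct xs \<and>
        typing \<Delta> \<Sigma>' (foldl App (Sym R) (map Var xs)) \<o> \<and>
        C = G @ [foldl App (Sym R) (map Var xs)])"

definition hochc :: "('v \<Rightarrow> ty) \<Rightarrow> ('c \<rightharpoonup> ty) \<Rightarrow> ('c \<rightharpoonup> ty) \<Rightarrow> ('v, 'c) clause \<Rightarrow> bool" where
  "hochc \<Delta> \<Sigma> \<Sigma>' C \<longleftrightarrow> goal_clause \<Delta> \<Sigma>' C \<or> definite_clause \<Delta> \<Sigma> \<Sigma>' C"

definition models :: "('v \<Rightarrow> ty) \<Rightarrow> ('c \<rightharpoonup> ty) \<Rightarrow> ('i, 'f) preframe \<Rightarrow>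
    ('c \<Rightarrow> ('i, 'f) val) \<Rightarrow> ('v, 'c) clause \<Rightarrow> bool" where
  "models \<Delta> \<Sigma>' H B C \<longleftrightarrow>
     (\<forall>\<alpha>. valuation \<Delta> H \<alpha> \<longrightarrow> (\<exists>L\<in>set C. is_true (den \<Delta> \<Sigma>' H B L \<alpha>)))"

definition satisfiable :: "('v \<Rightarrow> ty) \<Rightarrow> ('c \<rightharpoonup> ty) \<Rightarrow> ('c \<rightharpoonup> ty) \<Rightarrow> ('c, 'i) fo_struct \<Rightarrow>
    ('i, 'f) preframe \<Rightarrow> ('v, 'c) clause set \<Rightarrow> bool" where
  "satisfiable \<Delta> \<Sigma> \<Sigma>' A H \<Gamma> \<longleftrightarrow>
     (\<exists>B. expansion \<Sigma> \<Sigma>' A H B \<and> (\<forall>C\<in>\<Gamma>. models \<Delta> \<Sigma>' H B C))"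

end

theory Submission
  imports Defs "HOL.Filter"
begin

text \<open>Assume every finite \<open>i \<subseteq> \<Gamma>\<close> has a model \<open>B\<^sub>i\<close>. A logical relation compares an
  element of the frame with a family of elements indexed by the finite subsets of \<open>\<Gamma>\<close>: at type
  \<open>o\<close>, truth of the element must entail truth of the family eventually, along the filter of finite
  subsets. This plays the role of an ultraproduct of the \<open>B\<^sub>i\<close>, which itself need not live in the
  frame. Let \<open>B R\<close> be the least upper bound of all elements related to the family of the
  \<open>B\<^sub>i R\<close>. Atoms preserve the relation, so whatever is true in \<open>B\<close> is eventually true in the
  \<open>B\<^sub>i\<close>; this gives the goal clauses. For a definite clause, the abstraction of its body over the
  arguments of the head \<open>R\<close> is again related to the \<open>B\<^sub>i R\<close>, hence lies below \<open>B R\<close>.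
  Frames contain non-monotone functions, so the remaining variables of relational type are not
  related to themselves; they are moved to the constantly true relation, to which every element
  is related.\<close>

section \<open>The logical relation: tops, suprema and first-order types\<close>

fun lrel :: "('i, 'f) preframe \<Rightarrow> 'k filter \<Rightarrow> ty \<Rightarrow> ('i, 'f) val \<Rightarrow> ('k \<Rightarrow> ('i, 'f) val) \<Rightarrow> bool" where
  "lrel H F \<iota> a b \<longleftrightarrow> (\<forall>\<^sub>F i in F. b i = a)"
| "lrel H F \<o> a b \<longleftrightarrow> (is_true a \<longrightarrow> (\<forall>\<^sub>F i in F. is_true (b i)))"
| "lrel H F (\<sigma> \<^bold>\<rightarrow> \<sigma>') f g \<longleftrightarrow>
     (\<forall>a\<in>domain_of H \<sigma>. \<forall>b. (\<forall>i. b i \<in> domain_of H \<sigma>) \<longrightarrow> lrel H F \<sigma> a b \<longrightarrow>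
        lrel H F \<sigma>' (vapp H f a) (\<lambda>i. vapp H (g i) (b i)))"

text \<open>The constantly true relation; individuals carry no truth value, hence
  \<open>False\<close> at \<open>\<iota>\<close>.\<close>

fun is_top :: "('i, 'f) preframe \<Rightarrow> ty \<Rightarrow> ('i, 'f) val \<Rightarrow> bool" where
  "is_top H \<iota> u \<longleftrightarrow> False"
| "is_top H \<o> u \<longleftrightarrow> is_true u"
| "is_top H (\<tau> \<^bold>\<rightarrow> \<rho>) u \<longleftrightarrow> (\<forall>a\<in>domain_of H \<tau>. is_top H \<rho> (vapp H u a))"

text \<open>Relatedness at \<open>\<o>\<close> is an implication towards truth of the family, so a
  constantly true family satisfies it whatever \<open>f\<close> is. Arrows reduce to this by
  applying to an argument.\<close>

lemma lrel_is_top: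
  "(\<And>i. is_top H \<rho> (u i)) \<Longrightarrow> lrel H F \<rho> f u"
  by (induction \<rho> arbitrary: f u) auto

text \<open>At \<open>\<o>\<close> a true supremum is attained by a member of \<open>S\<close>, so
  the relatedness of that single member suffices and no infinite intersection of eventual events
  arises. At arrows suprema are pointwise.\<close>

lemma lrel_is_lub:
  "is_lub H \<rho> S u \<Longrightarrow> (\<And>f. f \<in> S \<Longrightarrow> lrel H F \<rho> f g) \<Longrightarrow> lrel H F \<rho> u g"
proof (induction \<rho> arbitrary: S u g)
  case Prop
  show ?case
  proof (clarsimp)
    assume "is_true u"
    then have "Bool True \<in> S" using Prop.prems(1) by (auto simp: is_true_def)
    from Prop.prems(2)[OF this] show "\<forall>\<^sub>F i in F. is_true (g i)" by (simp add: is_true_def)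
  qed
next
  case (Arrow \<tau> \<rho>)
  show ?case
  proof (clarsimp)
    fix a b
    assume ab: "a \<in> domain_of H \<tau>" "\<forall>i. b i \<in> domain_of H \<tau>" "lrel H F \<tau> a b"
    show "lrel H F \<rho> (vapp H u a) (\<lambda>i. vapp H (g i) (b i))"
    proof (rule Arrow.IH(2))
      show "is_lub H \<rho> ((\<lambda>f. vapp H f a) ` S) (vapp H u a)"
        using Arrow.prems(1) ab(1) by simp
    next
      fix f' assume "f' \<in> (\<lambda>f. vapp H f a) ` S"
      then show "lrel H F \<rho> f' (\<lambda>i. vapp H (g i) (b i))"
        using Arrow.prems(2) ab by auto
    qed
  qed
qed simp

text \<open>The upper-bound half of \<open>is_lub\<close>, read through a full list of arguments. It
  puts the abstracted body of a definite clause below the interpretation of the head symbol.\<close>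

lemma is_lub_upper:
  assumes "is_lub H (foldr (\<^bold>\<rightarrow>) ts \<o>) S u" and "f \<in> S"
    and "list_all2 (\<lambda>a t. a \<in> domain_of H t) as ts"
    and "is_true (foldl (vapp H) f as)"
  shows "is_true (foldl (vapp H) u as)"
  using assms
proof (induction ts arbitrary: S u f as)
  case Nil
  then show ?case by (auto simp: is_true_def)
next
  case (Cons t ts)
  from Cons.prems(3) obtain a as' where as: "as = a # as'" "a \<in> domain_of H t"
    "list_all2 (\<lambda>a t. a \<in> domain_of H t) as' ts"
    by (auto simp: list_all2_Cons2)
  have "is_true (foldl (vapp H) (vapp H u a) as')"
  proof (rule Cons.IH)
    show "is_lub H (foldr (\<^bold>\<rightarrow>) ts \<o>) ((\<lambda>f. vapp H f a) ` S) (vapp H u a)"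
      using Cons.prems(1) as by simp
    show "vapp H f a \<in> (\<lambda>f. vapp H f a) ` S" using Cons.prems(2) by simp
  qed (use as Cons.prems in auto)
  then show ?case using as by simp
qed

text \<open>The relation at \<open>\<iota>\<close> is eventual equality, so related individuals give
  eventually equal values, and eventual equality passes down the arrows to the result type.\<close>

lemma lrel_fo_type:
  fixes f :: "('a, 'b) val"
  shows "fo_type \<sigma> \<Longrightarrow> (\<forall>\<^sub>F i in F. g i = f) \<Longrightarrow> lrel H F \<sigma> f g"
proof (induction \<sigma> arbitrary: f g rule: fo_type.induct)
  case 2
  show ?case
  proof clarsimp
    fix a b
    assume "is_true (vapp H f a)" "\<forall>\<^sub>F i in F. b i = a"
    with 2 show "\<forall>\<^sub>F i in F. is_true (vapp H (g i) (b i))"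
      by (auto elim: eventually_elim2)
  qed
next
  case (3 \<sigma>)
  show ?case
  proof clarsimp
    fix a :: "('a, 'b) val" and b
    assume "\<forall>\<^sub>F i in F. b i = a"
    with "3.prems" have "\<forall>\<^sub>F i in F. vapp H (g i) (b i) = vapp H f a"
      by (auto elim: eventually_elim2)
    then show "lrel H F \<sigma> (vapp H f a) (\<lambda>i. vapp H (g i) (b i))" by (rule "3.IH")
  qed
qed simp

section \<open>Extensionality and uniqueness of first-order interpretations\<close>

lemma pre_frame_vapp:
  assumes "pre_frame H" "is_type (\<sigma> \<^bold>\<rightarrow> \<sigma>')" "f \<in> domain_of H (\<sigma> \<^bold>\<rightarrow> \<sigma>')" "a \<in> domain_of H \<sigma>"
  shows "vapp H f a \<in> domain_of H \<sigma>'"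
  using assms unfolding pre_frame_def by blast

lemma pre_frame_ext:
  assumes "pre_frame H" "is_type (\<sigma> \<^bold>\<rightarrow> \<sigma>')"
    and "f \<in> domain_of H (\<sigma> \<^bold>\<rightarrow> \<sigma>')" "g \<in> domain_of H (\<sigma> \<^bold>\<rightarrow> \<sigma>')"
    and "\<And>a. a \<in> domain_of H \<sigma> \<Longrightarrow> vapp H f a = vapp H g a"
  shows "f = g"
  using assms unfolding pre_frame_def by blast

lemma fo_type_iotas:
  "fo_type \<sigma> \<Longrightarrow> \<exists>n. \<sigma> = iotas n \<iota> \<or> \<sigma> = iotas n \<o>"
proof (induction rule: fo_type.induct)
  case 1
  have "\<iota> = iotas 0 \<iota>" by simp
  then show ?case by blast
next
  case 2
  have "\<iota> \<^bold>\<rightarrow> \<o> = iotas 1 \<o>" by simp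
  then show ?case by blast
next
  case (3 \<sigma>)
  then obtain n where "\<sigma> = iotas n \<iota> \<or> \<sigma> = iotas n \<o>" by blast
  then have "\<iota> \<^bold>\<rightarrow> \<sigma> = iotas (Suc n) \<iota> \<or> \<iota> \<^bold>\<rightarrow> \<sigma> = iotas (Suc n) \<o>" by auto
  then show ?case by blast
qed

text \<open>Extensionality at each arrow, by induction on the number of arguments. The alternative
  \<open>iotas n \<beta> = \<o>\<close> is there because \<open>\<o>\<close> is no first-order type,
  yet remains when the last argument of a predicate type is stripped.\<close>

lemma fo_type_ext:
  assumes "pre_frame H" "fo_type (iotas n \<beta>) \<or> iotas n \<beta> = \<o>"
    and "f \<in> domain_of H (iotas n \<beta>)" "g \<in> domain_of H (iotas n \<beta>)"
    and "\<And>as. length as = n \<Longrightarrow> set as \<subseteq> inds H \<Longrightarrow>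
           foldl (vapp H) f (map Ind as) = foldl (vapp H) g (map Ind as)"
  shows "f = g"
  using assms(2-)
proof (induction n arbitrary: f g)
  case 0
  then show ?case using "0.prems"(4)[of "[]"] by simp
next
  case (Suc n)
  have ty: "fo_type (\<iota> \<^bold>\<rightarrow> iotas n \<beta>)" using Suc.prems(1) by simp
  then have ty': "is_type (\<iota> \<^bold>\<rightarrow> iotas n \<beta>)" by (simp add: is_type_def)
  have ty'': "fo_type (iotas n \<beta>) \<or> iotas n \<beta> = \<o>"
    using ty by (auto elim: fo_type.cases)
  have f: "f \<in> domain_of H (\<iota> \<^bold>\<rightarrow> iotas n \<beta>)" and g: "g \<in> domain_of H (\<iota> \<^bold>\<rightarrow> iotas n \<beta>)"
    using Suc.prems(2,3) by simp_all
  show ?case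
  proof (rule pre_frame_ext[OF assms(1) ty' f g])
    fix a assume a: "a \<in> domain_of H \<iota>"
    then obtain j where j: "a = Ind j" "j \<in> inds H" by auto
    show "vapp H f a = vapp H g a"
    proof (rule Suc.IH[OF ty''])
      fix as :: "'a list" assume "length as = n" "set as \<subseteq> inds H"
      then show "foldl (vapp H) (vapp H f a) (map Ind as) = foldl (vapp H) (vapp H g a) (map Ind as)"
        using Suc.prems(4)[of "j # as"] j by simp
    qed (use pre_frame_vapp[OF assms(1) ty' _ a] f g in auto)
  qed
qed

text \<open>\<open>A\<close> prescribes the values on all argument lists over the carrier, which
  settles the element by extensionality. Hence all expansions of \<open>A\<close> agree on the
  symbols of \<open>\<Sigma>\<close>.\<close>

lemma represents_unique:
  assumes "pre_frame H" "inds H = carrier A" "fo_type \<sigma>"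
    and "represents H A c \<sigma> v" "represents H A c \<sigma> w"
  shows "v = w"
proof -
  obtain n \<beta> where n: "\<sigma> = iotas n \<beta>" "\<beta> = \<iota> \<or> \<beta> = \<o>"
    using fo_type_iotas[OF assms(3)] by blast
  show ?thesis
    by (rule fo_type_ext[OF assms(1), of n \<beta>]) (use assms n in \<open>auto simp: represents_def\<close>)
qed

section \<open>Types and typing of terms\<close>

lemma arg_type_is_type: "arg_type \<tau> \<Longrightarrow> is_type \<tau>"
  by (auto elim: arg_type.cases simp: is_type_def intro: fo_type.intros)

lemma rel_type_ArrowD: "rel_type (\<sigma> \<^bold>\<rightarrow> \<sigma>') \<Longrightarrow> arg_type \<sigma> \<and> rel_type \<sigma>'"
  by (erule rel_type.cases) auto

lemma is_type_Arrow2: "is_type (\<sigma> \<^bold>\<rightarrow> \<sigma>') \<Longrightarrow> is_type \<sigma>'"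
  by (auto simp: is_type_def dest: rel_type_ArrowD elim: fo_type.cases
      intro: arg_type_rel_type.intros)

text \<open>Closure of pre-frames under application is stated only at admissible types; this makes
  it available at the types of subterms.\<close>

lemma typing_is_type:
  assumes "type_env \<Delta>" "signature \<Sigma>" "typing \<Delta> \<Sigma> M \<sigma>"
  shows "is_type \<sigma>"
  using assms(3)
proof (induction rule: typing.induct)
  case (1 x)
  then show ?case using assms(1) by (simp add: type_env_def arg_type_is_type)
next
  case (2 c \<sigma>)
  then show ?case using assms(2) by (simp add: signature_def)
next
  case (7 M \<sigma> \<sigma>' N)
  then show ?case by (blast dest: is_type_Arrow2)
next
  case (8 M \<rho> x)
  then show ?case using assms(1)
    by (auto simp: type_env_def is_type_def intro: arg_type_rel_type.intros)
qed (auto simp: is_type_def intro: arg_type_rel_type.intros)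

lemma no_logical_symbol_positive: "no_logical_symbol M \<Longrightarrow> positive_existential M"
  by (induction M) auto

lemma typing_foldl_App:
  assumes "typing \<Delta> \<Sigma> (foldl App M (map Var xs)) \<sigma>"
  shows "typing \<Delta> \<Sigma> M (foldr (\<^bold>\<rightarrow>) (map \<Delta> xs) \<sigma>)"
  using assms
proof (induction xs arbitrary: M)
  case (Cons x xs)
  then have "typing \<Delta> \<Sigma> (App M (Var x)) (foldr (\<^bold>\<rightarrow>) (map \<Delta> xs) \<sigma>)" by simp
  then obtain \<tau> where "typing \<Delta> \<Sigma> M (\<tau> \<^bold>\<rightarrow> foldr (\<^bold>\<rightarrow>) (map \<Delta> xs) \<sigma>)" "typing \<Delta> \<Sigma> (Var x) \<tau>"
    by (auto elim: typing.cases)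
  moreover from this(2) have "\<tau> = \<Delta> x" by (auto elim: typing.cases)
  ultimately show ?case by simp
qed simp

lemma den_foldl_App_Var:
  "den \<Delta> \<Sigma> H B (foldl App M (map Var xs)) \<alpha> = foldl (vapp H) (den \<Delta> \<Sigma> H B M \<alpha>) (map \<alpha> xs)"
  by (induction xs arbitrary: M) auto

text \<open>The term language has no constant for truth; \<open>\<exists>z. z\<close> with \<open>z : o\<close> replaces it.\<close>

definition truth :: "'v \<Rightarrow> ('v, 'c) tm" where
  "truth z = App (Ex \<o>) (Lam z (Var z))"

text \<open>Ending in \<open>truth z\<close> gives a term also for the empty list, that is, for a
  definite clause without negative literals.\<close>

definition conjunction :: "'v \<Rightarrow> ('v, 'c) tm list \<Rightarrow> ('v, 'c) tm" where
  "conjunction z Ms = foldr (\<lambda>M N. App (App And M) N) Ms (truth z)"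

section \<open>Denotations in a frame\<close>

locale framed =
  fixes \<Delta> :: "'v \<Rightarrow> ty" and \<Sigma> :: "'c \<rightharpoonup> ty" and H :: "('i, 'f) preframe"
  assumes type_env: "type_env \<Delta>"
    and signature: "signature \<Sigma>"
    and frame: "frame TYPE('c) \<Delta> H"
begin

lemma pre_frame: "pre_frame H"
  using frame by (simp add: frame_def)

lemma arg_type_var: "arg_type (\<Delta> x)"
  using type_env by (simp add: type_env_def)

lemma valuation_upd:
  "valuation \<Delta> H \<alpha> \<Longrightarrow> r \<in> domain_of H (\<Delta> x) \<Longrightarrow> valuation \<Delta> H (\<alpha>(x := r))"
  by (simp add: valuation_def)

text \<open>Comprehension, with the typing of the body as its premise. Abstractions are evaluated
  through these two facts rather than through the \<open>THE\<close> in \<open>den\<close>.\<close>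

lemma den_Lam:
  assumes "structure \<Sigma> H B" "valuation \<Delta> H \<alpha>" "positive_existential M"
    and "typing \<Delta> \<Sigma> M \<rho>" "rel_type \<rho>"
  shows "den \<Delta> \<Sigma> H B (Lam x M) \<alpha> \<in> domain_of H (\<Delta> x \<^bold>\<rightarrow> \<rho>)"
    and "r \<in> domain_of H (\<Delta> x) \<Longrightarrow>
      vapp H (den \<Delta> \<Sigma> H B (Lam x M) \<alpha>) r = den \<Delta> \<Sigma> H B M (\<alpha>(x := r))"
proof -
  have "typing \<Delta> \<Sigma> (Lam x M) (\<Delta> x \<^bold>\<rightarrow> \<rho>)" using assms(4,5) by (rule typing.intros)
  then have "den \<Delta> \<Sigma> H B (Lam x M) \<alpha> \<in> domain_of H (\<Delta> x \<^bold>\<rightarrow> \<rho>) \<and>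
        (\<forall>r\<in>domain_of H (\<Delta> x).
           vapp H (den \<Delta> \<Sigma> H B (Lam x M) \<alpha>) r = den \<Delta> \<Sigma> H B M (\<alpha>(x := r)))"
    using conjunct2[OF frame[unfolded frame_def], rule_format, of \<Sigma> B \<alpha> x M \<rho>]
      signature assms(1-3) by (simp del: den.simps domain_of.simps)
  then show "den \<Delta> \<Sigma> H B (Lam x M) \<alpha> \<in> domain_of H (\<Delta> x \<^bold>\<rightarrow> \<rho>)"
    and "r \<in> domain_of H (\<Delta> x) \<Longrightarrow>
      vapp H (den \<Delta> \<Sigma> H B (Lam x M) \<alpha>) r = den \<Delta> \<Sigma> H B M (\<alpha>(x := r))"
    by blast+
qed

lemma den_in_domain:
  assumes "structure \<Sigma> H B" "typing \<Delta> \<Sigma> M \<sigma>" "no_logical_symbol M" "valuation \<Delta> H \<alpha>"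
  shows "den \<Delta> \<Sigma> H B M \<alpha> \<in> domain_of H \<sigma>"
  using assms(2-)
proof (induction arbitrary: \<alpha> rule: typing.induct)
  case (1 x)
  then show ?case by (simp add: valuation_def)
next
  case (2 c \<sigma>)
  then show ?case using assms(1) by (simp add: structure_def)
next
  case (7 M \<sigma> \<sigma>' N)
  then show ?case
    using pre_frame_vapp[OF pre_frame typing_is_type[OF type_env signature 7(1)]] by simp
next
  case (8 M \<rho> x)
  then show ?case
    using den_Lam(1)[OF assms(1)] by (simp add: no_logical_symbol_positive del: den.simps)
qed auto

text \<open>The fundamental lemma of logical relations. Application uses the arrow clause of
  \<open>lrel\<close>, whose arguments must lie in the domain; abstraction extends both valuations
  by related arguments. Negation would break it, as truth is transferred in one direction
  only.\<close>

lemma lrel_den: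
  assumes "structure \<Sigma> H B" "\<And>i. structure \<Sigma> H (B' i)"
    and "\<And>c \<sigma>. \<Sigma> c = Some \<sigma> \<Longrightarrow> lrel H F \<sigma> (B c) (\<lambda>i. B' i c)"
    and "typing \<Delta> \<Sigma> M \<sigma>" "no_logical_symbol M"
    and "valuation \<Delta> H \<alpha>" "\<And>i. valuation \<Delta> H (\<alpha>' i)"
    and "\<And>x. lrel H F (\<Delta> x) (\<alpha> x) (\<lambda>i. \<alpha>' i x)"
  shows "lrel H F \<sigma> (den \<Delta> \<Sigma> H B M \<alpha>) (\<lambda>i. den \<Delta> \<Sigma> H (B' i) M (\<alpha>' i))"
  using assms(4-)
proof (induction arbitrary: \<alpha> \<alpha>' rule: typing.induct)
  case (2 c \<sigma>)
  then show ?case using assms(3) by simp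
next
  case (7 M \<sigma> \<sigma>' N)
  have nl: "no_logical_symbol M" "no_logical_symbol N" using 7 by auto
  have "lrel H F (\<sigma> \<^bold>\<rightarrow> \<sigma>') (den \<Delta> \<Sigma> H B M \<alpha>) (\<lambda>i. den \<Delta> \<Sigma> H (B' i) M (\<alpha>' i))"
    using 7 nl by blast
  moreover have "lrel H F \<sigma> (den \<Delta> \<Sigma> H B N \<alpha>) (\<lambda>i. den \<Delta> \<Sigma> H (B' i) N (\<alpha>' i))"
    using 7 nl by blast
  moreover have "den \<Delta> \<Sigma> H B N \<alpha> \<in> domain_of H \<sigma>"
    "\<And>i. den \<Delta> \<Sigma> H (B' i) N (\<alpha>' i) \<in> domain_of H \<sigma>"
    using den_in_domain[OF assms(1) "7.hyps"(2) nl(2) "7.prems"(2)]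
      den_in_domain[OF assms(2) "7.hyps"(2) nl(2) "7.prems"(3)] by simp_all
  ultimately show ?case by simp
next
  case (8 M \<rho> x)
  have nl: "no_logical_symbol M" "positive_existential M"
    using "8.prems"(1) by (auto intro: no_logical_symbol_positive)
  show ?case
    unfolding lrel.simps
  proof (intro ballI allI impI)
    fix a b
    assume ab: "a \<in> domain_of H (\<Delta> x)" "\<forall>i. b i \<in> domain_of H (\<Delta> x)" "lrel H F (\<Delta> x) a b"
    have "lrel H F \<rho> (den \<Delta> \<Sigma> H B M (\<alpha>(x := a)))
        (\<lambda>i. den \<Delta> \<Sigma> H (B' i) M ((\<alpha>' i)(x := b i)))"
      using 8 nl ab by (intro "8.IH") (auto simp: valuation_def)
    moreover have "vapp H (den \<Delta> \<Sigma> H B (Lam x M) \<alpha>) a = den \<Delta> \<Sigma> H B M (\<alpha>(x := a))"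
      by (rule den_Lam(2)[OF assms(1) "8.prems"(2) nl(2) "8.hyps" ab(1)])
    moreover have "vapp H (den \<Delta> \<Sigma> H (B' i) (Lam x M) (\<alpha>' i)) (b i)
        = den \<Delta> \<Sigma> H (B' i) M ((\<alpha>' i)(x := b i))" for i
      using ab(2) by (intro den_Lam(2)[OF assms(2) "8.prems"(3) nl(2) "8.hyps"]) simp
    ultimately show "lrel H F \<rho> (vapp H (den \<Delta> \<Sigma> H B (Lam x M) \<alpha>) a)
        (\<lambda>i. vapp H (den \<Delta> \<Sigma> H (B' i) (Lam x M) (\<alpha>' i)) (b i))"
      by (simp del: den.simps)
  qed
qed auto

lemma is_type_logical: "is_type (\<o> \<^bold>\<rightarrow> \<o>)" "is_type (\<o> \<^bold>\<rightarrow> \<o> \<^bold>\<rightarrow> \<o>)" "is_type ((\<o> \<^bold>\<rightarrow> \<o>) \<^bold>\<rightarrow> \<o>)"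
  by (auto simp: is_type_def intro!: arg_type_rel_type.intros)

text \<open>\<open>den\<close> selects the minimum by \<open>THE\<close>; its uniqueness is
  extensionality, applied once for each argument.\<close>

lemma den_And: "vapp H (vapp H (den \<Delta> \<Sigma> H B And \<alpha>) (Bool a)) (Bool b) = Bool (a \<and> b)"
proof -
  obtain f where f: "is_min H f" using pre_frame by (auto simp: pre_frame_def)
  have "g = f" if g: "is_min H g" for g
  proof (rule pre_frame_ext[OF pre_frame is_type_logical(2)])
    fix a assume a: "a \<in> domain_of H \<o>"
    show "vapp H g a = vapp H f a"
    proof (rule pre_frame_ext[OF pre_frame is_type_logical(1)])
      show "vapp H g a \<in> domain_of H (\<o> \<^bold>\<rightarrow> \<o>)" "vapp H f a \<in> domain_of H (\<o> \<^bold>\<rightarrow> \<o>)"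
        using pre_frame_vapp[OF pre_frame is_type_logical(2) _ a] f g unfolding is_min_def by blast+
      show "vapp H (vapp H g a) b = vapp H (vapp H f a) b" if "b \<in> domain_of H \<o>" for b
        using that a f g by (auto simp: is_min_def)
    qed
  qed (use f g in \<open>auto simp: is_min_def\<close>)
  then have "(THE f. is_min H f) = f" using f by blast
  then show ?thesis using f by (simp add: is_min_def)
qed

lemma den_Ex_prop:
  assumes "r \<in> domain_of H (\<o> \<^bold>\<rightarrow> \<o>)"
  shows "vapp H (den \<Delta> \<Sigma> H B (Ex \<o>) \<alpha>) r = Bool (\<exists>s\<in>domain_of H \<o>. is_true (vapp H r s))"
proof -
  have "arg_type \<o>" by (intro arg_type_rel_type.intros)
  then obtain f where f: "is_exists H \<o> f" using pre_frame unfolding pre_frame_def by blast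
  have "g = f" if g: "is_exists H \<o> g" for g
    by (rule pre_frame_ext[OF pre_frame is_type_logical(3)]) (use f g in \<open>auto simp: is_exists_def\<close>)
  then have "(THE f. is_exists H \<o> f) = f" using f by blast
  then show ?thesis using f assms unfolding is_exists_def den.simps by blast
qed

lemma truth:
  assumes z: "\<Delta> z = \<o>"
  shows "typing \<Delta> \<Sigma> (truth z) \<o>" "positive_existential (truth z)"
    and "structure \<Sigma> H B \<Longrightarrow> valuation \<Delta> H \<alpha> \<Longrightarrow> den \<Delta> \<Sigma> H B (truth z) \<alpha> = Bool True"
proof -
  have var: "typing \<Delta> \<Sigma> (Var z) \<o>" using typing.intros(1)[of \<Delta> \<Sigma> z] z by simp
  have o: "rel_type \<o>" by (intro arg_type_rel_type.intros)
  show "typing \<Delta> \<Sigma> (truth z) \<o>"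
    unfolding truth_def
    by (rule typing.intros(7)[OF typing.intros(6)])
      (use typing.intros(8)[OF var o, of z] z o in \<open>auto intro: arg_type_rel_type.intros\<close>)
  show "positive_existential (truth z)" by (simp add: truth_def)
  assume B: "structure \<Sigma> H B" and \<alpha>: "valuation \<Delta> H \<alpha>"
  note L = den_Lam[OF B \<alpha> _ var o, where x = z, unfolded z]
  \<comment> \<open>The value 1 is the witness for \<open>\<exists>z. z\<close>.\<close>
  have "is_true (vapp H (den \<Delta> \<Sigma> H B (Lam z (Var z)) \<alpha>) (Bool True))"
    using L(2)[of "Bool True"] by (simp add: is_true_def del: den.simps(8))
  then show "den \<Delta> \<Sigma> H B (truth z) \<alpha> = Bool True"
    using den_Ex_prop[OF L(1)] by (auto simp: truth_def simp del: den.simps(6,8))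
qed

lemma conjunction:
  assumes z: "\<Delta> z = \<o>" and Ms: "\<And>M. M \<in> set Ms \<Longrightarrow> atom \<Delta> \<Sigma> M"
  shows "typing \<Delta> \<Sigma> (conjunction z Ms) \<o>" "positive_existential (conjunction z Ms)"
    and "structure \<Sigma> H B \<Longrightarrow> valuation \<Delta> H \<alpha> \<Longrightarrow>
      den \<Delta> \<Sigma> H B (conjunction z Ms) \<alpha> = Bool (\<forall>M\<in>set Ms. is_true (den \<Delta> \<Sigma> H B M \<alpha>))"
proof -
  show "typing \<Delta> \<Sigma> (conjunction z Ms) \<o>"
    using Ms truth(1)[OF z]
    by (induction Ms) (auto simp: conjunction_def atom_def intro!: typing.intros(4,7))
  show "positive_existential (conjunction z Ms)"
    using Ms truth(2)[OF z]
    by (induction Ms) (auto simp: conjunction_def atom_def intro: no_logical_symbol_positive)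
  assume B: "structure \<Sigma> H B" and \<alpha>: "valuation \<Delta> H \<alpha>"
  show "den \<Delta> \<Sigma> H B (conjunction z Ms) \<alpha> = Bool (\<forall>M\<in>set Ms. is_true (den \<Delta> \<Sigma> H B M \<alpha>))"
    using Ms
  proof (induction Ms)
    case Nil
    then show ?case using truth(3)[OF z B \<alpha>] by (simp add: conjunction_def)
  next
    case (Cons M Ms)
    \<comment> \<open>\<open>den_And\<close> speaks of truth values only, so the denotation of the
      atom is first brought into the form \<open>Bool b\<close>.\<close>
    have "den \<Delta> \<Sigma> H B M \<alpha> \<in> domain_of H \<o>"
      using Cons.prems[of M] den_in_domain[OF B _ _ \<alpha>] unfolding atom_def
      by (meson list.set_intros(1))
    then obtain b where b: "den \<Delta> \<Sigma> H B M \<alpha> = Bool b" by auto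
    have "den \<Delta> \<Sigma> H B (conjunction z (M # Ms)) \<alpha> =
        vapp H (vapp H (den \<Delta> \<Sigma> H B And \<alpha>) (den \<Delta> \<Sigma> H B M \<alpha>)) (den \<Delta> \<Sigma> H B (conjunction z Ms) \<alpha>)"
      by (simp add: conjunction_def)
    also have "\<dots> = Bool (b \<and> (\<forall>M\<in>set Ms. is_true (den \<Delta> \<Sigma> H B M \<alpha>)))"
      using Cons b by (simp add: den_And del: den.simps)
    finally show ?case using b by (simp add: is_true_def)
  qed
qed

section \<open>Iterated abstraction over a list of variables\<close>

lemma rel_type_foldr: "rel_type (foldr (\<^bold>\<rightarrow>) (map \<Delta> xs) \<o>)"
  by (induction xs) (auto intro: arg_type_rel_type.intros arg_type_var)

lemma foldr_Lam:
  assumes "typing \<Delta> \<Sigma> M \<o>" "positive_existential M"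
  shows "typing \<Delta> \<Sigma> (foldr Lam xs M) (foldr (\<^bold>\<rightarrow>) (map \<Delta> xs) \<o>)"
    and "positive_existential (foldr Lam xs M)"
  using assms by (induction xs) (auto intro: typing.intros rel_type_foldr)

lemma vapp_foldr_Lam:
  assumes "structure \<Sigma> H B" "valuation \<Delta> H \<alpha>" "typing \<Delta> \<Sigma> M \<o>" "positive_existential M"
    and "r \<in> domain_of H (\<Delta> x)"
  shows "vapp H (den \<Delta> \<Sigma> H B (foldr Lam (x # xs) M) \<alpha>) r
      = den \<Delta> \<Sigma> H B (foldr Lam xs M) (\<alpha>(x := r))"
  using den_Lam(2)[OF assms(1,2) foldr_Lam(2,1)[OF assms(3,4)] rel_type_foldr assms(5)]
  by (simp del: den.simps)

text \<open>The last assumption serves the empty list; otherwise comprehension for the outermost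
  abstraction gives the claim.\<close>

lemma den_foldr_Lam_in_domain:
  assumes "structure \<Sigma> H B" "valuation \<Delta> H \<alpha>" "typing \<Delta> \<Sigma> M \<o>" "positive_existential M"
    and "den \<Delta> \<Sigma> H B M \<alpha> \<in> domain_of H \<o>"
  shows "den \<Delta> \<Sigma> H B (foldr Lam xs M) \<alpha> \<in> domain_of H (foldr (\<^bold>\<rightarrow>) (map \<Delta> xs) \<o>)"
proof (cases xs)
  case Nil
  then show ?thesis using assms by simp
next
  case (Cons x ys)
  then show ?thesis
    using den_Lam(1)[OF assms(1,2) foldr_Lam(2,1)[OF assms(3,4)] rel_type_foldr]
    by (simp del: den.simps domain_of.simps)
qed

text \<open>The arguments are the values under \<open>\<alpha>\<close> of the abstracted variables,
  so every update \<open>\<alpha>(x := \<alpha> x)\<close> gives \<open>\<alpha>\<close>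
  back.\<close>

lemma foldl_vapp_foldr_Lam:
  assumes "structure \<Sigma> H B" "valuation \<Delta> H \<alpha>" "typing \<Delta> \<Sigma> M \<o>" "positive_existential M"
  shows "foldl (vapp H) (den \<Delta> \<Sigma> H B (foldr Lam xs M) \<alpha>) (map \<alpha> xs) = den \<Delta> \<Sigma> H B M \<alpha>"
proof (induction xs)
  case (Cons x xs)
  have "\<alpha> x \<in> domain_of H (\<Delta> x)" using assms(2) by (simp add: valuation_def)
  from vapp_foldr_Lam[OF assms this, of xs] Cons show ?case by (simp del: den.simps foldr.simps)
qed simp

text \<open>\<open>M\<close> may contain logical symbols and \<open>g\<close> is an arbitrary
  family, so \<open>lrel_den\<close> does not apply. Applying both sides to related arguments, one
  variable at a time, leaves the implication of truth at \<open>\<o>\<close>. Agreement of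
  \<open>\<beta>'\<close> with \<open>\<alpha>'\<close> off \<open>xs\<close> is the invariant of
  the induction.\<close>

lemma lrel_foldr_Lam:
  assumes "structure \<Sigma> H B" "typing \<Delta> \<Sigma> M \<o>" "positive_existential M" "distinct xs"
    and "valuation \<Delta> H \<alpha>" "\<And>i. valuation \<Delta> H (\<alpha>' i)"
    and "\<And>x. lrel H F (\<Delta> x) (\<alpha> x) (\<lambda>i. \<alpha>' i x)"
    and "\<And>\<beta> \<beta>'. valuation \<Delta> H \<beta> \<Longrightarrow> (\<And>i. valuation \<Delta> H (\<beta>' i)) \<Longrightarrow>
      (\<And>x. lrel H F (\<Delta> x) (\<beta> x) (\<lambda>i. \<beta>' i x)) \<Longrightarrow>
      (\<And>x i. x \<notin> set xs \<Longrightarrow> \<beta>' i x = \<alpha>' i x) \<Longrightarrow>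
      is_true (den \<Delta> \<Sigma> H B M \<beta>) \<Longrightarrow> \<forall>\<^sub>F i in F. is_true (foldl (vapp H) (g i) (map (\<beta>' i) xs))"
  shows "lrel H F (foldr (\<^bold>\<rightarrow>) (map \<Delta> xs) \<o>) (den \<Delta> \<Sigma> H B (foldr Lam xs M) \<alpha>) g"
  using assms(4-)
proof (induction xs arbitrary: \<alpha> \<alpha>' g)
  case Nil
  then show ?case using Nil.prems(5)[of \<alpha> \<alpha>'] by simp
next
  case (Cons x xs)
  have "lrel H F (foldr (\<^bold>\<rightarrow>) (map \<Delta> xs) \<o>) (vapp H (den \<Delta> \<Sigma> H B (foldr Lam (x # xs) M) \<alpha>) a)
      (\<lambda>i. vapp H (g i) (b i))"
    if ab: "a \<in> domain_of H (\<Delta> x)" "\<forall>i. b i \<in> domain_of H (\<Delta> x)" "lrel H F (\<Delta> x) a b" for a b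
    unfolding vapp_foldr_Lam[OF assms(1) Cons.prems(2) assms(2,3) ab(1)]
  proof (rule Cons.IH[where \<alpha>' = "\<lambda>i. (\<alpha>' i)(x := b i)"])
    fix \<beta> \<beta>'
    assume \<beta>: "valuation \<Delta> H \<beta>" "\<And>i. valuation \<Delta> H (\<beta>' i)"
      "\<And>x. lrel H F (\<Delta> x) (\<beta> x) (\<lambda>i. \<beta>' i x)"
      "\<And>y i. y \<notin> set xs \<Longrightarrow> \<beta>' i y = ((\<alpha>' i)(x := b i)) y"
      "is_true (den \<Delta> \<Sigma> H B M \<beta>)"
    have "\<forall>\<^sub>F i in F. is_true (foldl (vapp H) (g i) (map (\<beta>' i) (x # xs)))"
      by (rule Cons.prems(5)[OF \<beta>(1-3) _ \<beta>(5)]) (use \<beta>(4) in auto)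
    \<comment> \<open>By distinctness \<open>x\<close> is not in the tail, so no later update
      overwrites the argument given to it.\<close>
    moreover have "\<beta>' i x = b i" for i using \<beta>(4)[of x i] Cons.prems(1) by simp
    ultimately show "\<forall>\<^sub>F i in F. is_true (foldl (vapp H) (vapp H (g i) (b i)) (map (\<beta>' i) xs))"
      by simp
  qed (use Cons.prems ab in \<open>auto simp: valuation_def\<close>)
  then show ?case by (simp del: den.simps foldr.simps(2) add: foldr.simps(2)[of "(\<^bold>\<rightarrow>)"])
qed

section \<open>Top elements and dominating valuations\<close>

lemma ex_var: "arg_type \<tau> \<Longrightarrow> \<exists>x. \<Delta> x = \<tau>"
  using type_env unfolding type_env_def by (metis (mono_tags, lifting) empty_Collect_eq finite.emptyI)

text \<open>Every argument type has a variable, so each relational type is the type of an iterated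
  abstraction, and comprehension can supply elements of it.\<close>

lemma rel_type_eq_foldr: "rel_type \<rho> \<Longrightarrow> \<exists>xs. \<rho> = foldr (\<^bold>\<rightarrow>) (map \<Delta> xs) \<o>"
proof (induction \<rho>)
  case Iota
  then show ?case by (auto elim: rel_type.cases)
next
  case Prop
  show ?case by (rule exI[of _ "[]"]) simp
next
  case (Arrow \<tau> \<rho>)
  then obtain x xs where "\<tau> = \<Delta> x" "\<rho> = foldr (\<^bold>\<rightarrow>) (map \<Delta> xs) \<o>"
    using rel_type_ArrowD ex_var by metis
  then show ?case by (intro exI[of _ "x # xs"]) simp
qed

text \<open>The witness is the iterated abstraction of \<open>truth z\<close>, whose body is true
  under every valuation.\<close>

lemma ex_is_top:
  assumes B: "structure \<Sigma> H B" and \<alpha>: "valuation \<Delta> H \<alpha>" and "rel_type \<rho>"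
  shows "\<exists>u\<in>domain_of H \<rho>. is_top H \<rho> u"
proof -
  obtain xs where xs: "\<rho> = foldr (\<^bold>\<rightarrow>) (map \<Delta> xs) \<o>" using rel_type_eq_foldr assms(3) by blast
  obtain z where z: "\<Delta> z = \<o>" using ex_var[of \<o>] by (auto intro: arg_type_rel_type.intros)
  note t = truth(1,2)[OF z]
  have "is_top H (foldr (\<^bold>\<rightarrow>) (map \<Delta> xs) \<o>) (den \<Delta> \<Sigma> H B (foldr Lam xs (truth z)) \<alpha>)"
    using \<alpha>
  proof (induction xs arbitrary: \<alpha>)
    case Nil
    then show ?case using truth(3)[OF z B] by (simp add: is_true_def)
  next
    case (Cons x xs)
    have "is_top H (foldr (\<^bold>\<rightarrow>) (map \<Delta> xs) \<o>)
        (vapp H (den \<Delta> \<Sigma> H B (foldr Lam (x # xs) (truth z)) \<alpha>) a)"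
      if "a \<in> domain_of H (\<Delta> x)" for a
      unfolding vapp_foldr_Lam[OF B Cons.prems t that]
      by (rule Cons.IH[OF valuation_upd[OF Cons.prems that]])
    then show ?case by (simp del: den.simps foldr.simps(2) add: foldr.simps(2)[of "(\<^bold>\<rightarrow>)"])
  qed
  moreover have "den \<Delta> \<Sigma> H B (foldr Lam xs (truth z)) \<alpha> \<in> domain_of H (foldr (\<^bold>\<rightarrow>) (map \<Delta> xs) \<o>)"
    by (rule den_foldr_Lam_in_domain[OF B \<alpha> t]) (simp add: truth(3)[OF z B \<alpha>])
  ultimately show ?thesis using xs by blast
qed

text \<open>Individual variables keep their values, since the relation at \<open>\<iota>\<close>
  demands eventual equality; all other argument types are relational and take a top element. One
  valuation serves all indices.\<close>

lemma ex_dominating_valuation: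
  assumes "structure \<Sigma> H B" and \<alpha>: "valuation \<Delta> H \<alpha>"
  obtains \<alpha>' where "valuation \<Delta> H \<alpha>'" "\<And>x. lrel H F (\<Delta> x) (\<alpha> x) (\<lambda>i. \<alpha>' x)"
proof -
  have "\<exists>u\<in>domain_of H (\<Delta> x). \<Delta> x = \<iota> \<and> u = \<alpha> x \<or> is_top H (\<Delta> x) u" for x
  proof (cases "\<Delta> x = \<iota>")
    case True
    then show ?thesis using \<alpha> unfolding valuation_def by metis
  next
    case False
    then have "rel_type (\<Delta> x)" using arg_type_var[of x] by (auto elim: arg_type.cases)
    then show ?thesis using ex_is_top[OF assms] by blast
  qed
  then obtain \<alpha>' where \<alpha>': "\<And>x. \<alpha>' x \<in> domain_of H (\<Delta> x)"
    "\<And>x. \<Delta> x = \<iota> \<and> \<alpha>' x = \<alpha> x \<or> is_top H (\<Delta> x) (\<alpha>' x)"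
    by metis
  have "lrel H F (\<Delta> x) (\<alpha> x) (\<lambda>i. \<alpha>' x)" for x
    using \<alpha>'(2)[of x] by (auto intro: lrel_is_top)
  then show ?thesis using \<alpha>'(1) that by (auto simp: valuation_def)
qed

end

section \<open>Compactness: from models of the finite subsets to a model of the whole set\<close>

theorem mainTheorem3:
  fixes \<Delta> :: "'v \<Rightarrow> ty"
    and \<Sigma> \<Sigma>' :: "'c \<rightharpoonup> ty"
    and A :: "('c, 'i) fo_struct"
    and H :: "('i, 'f) preframe"
    and \<Gamma> :: "('v, 'c) clause set"
  assumes "type_env \<Delta>"
    and "fo_signature \<Sigma>"
    and "signature \<Sigma>'"
    and "relational_extension \<Sigma> \<Sigma>'"
    and "fo_structure \<Sigma> A"
    and "frame TYPE('c) \<Delta> H"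
    and "complete_preframe H"
    and "expands \<Sigma> A H"
    and "\<forall>C\<in>\<Gamma>. hochc \<Delta> \<Sigma> \<Sigma>' C"
    and "\<not> satisfiable \<Delta> \<Sigma> \<Sigma>' A H \<Gamma>"
  shows "\<exists>\<Gamma>'\<subseteq>\<Gamma>. finite \<Gamma>' \<and> \<not> satisfiable \<Delta> \<Sigma> \<Sigma>' A H \<Gamma>'"
proof (rule ccontr)
  assume "\<not> ?thesis"
  then have sat: "satisfiable \<Delta> \<Sigma> \<Sigma>' A H i" if "finite i" "i \<subseteq> \<Gamma>" for i
    using that by blast
  interpret framed \<Delta> \<Sigma>' H by unfold_locales fact+
  define F where "F = finite_subsets_at_top \<Gamma>"
  \<comment> \<open>The lemmas ask for a structure at every index, so an index that is not a finite
    subset of \<open>\<Gamma>\<close> gets a default, an expansion obtained for the empty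
    set.\<close>
  have "\<exists>B. expansion \<Sigma> \<Sigma>' A H B \<and> (finite i \<and> i \<subseteq> \<Gamma> \<longrightarrow> (\<forall>C\<in>i. models \<Delta> \<Sigma>' H B C))" for i
    using sat[of i] sat[of "{}"] unfolding satisfiable_def by (cases "finite i \<and> i \<subseteq> \<Gamma>") auto
  then obtain B' where B': "\<And>i. expansion \<Sigma> \<Sigma>' A H (B' i)"
    "\<And>i C. finite i \<Longrightarrow> i \<subseteq> \<Gamma> \<Longrightarrow> C \<in> i \<Longrightarrow> models \<Delta> \<Sigma>' H (B' i) C"
    by metis
  have str': "structure \<Sigma>' H (B' i)" for i using B'(1) by (simp add: expansion_def)
  \<comment> \<open>From the index \<open>{C}\<close> upwards every finite subset contains
    \<open>C\<close>.\<close>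
  have ev_models: "\<forall>\<^sub>F i in F. models \<Delta> \<Sigma>' H (B' i) C" if "C \<in> \<Gamma>" for C
    unfolding F_def eventually_finite_subsets_at_top
    using that B'(2) by (intro exI[of _ "{C}"]) auto
  have sub: "\<Sigma>' c = Some \<sigma>" if "\<Sigma> c = Some \<sigma>" for c \<sigma>
    using that assms(4) by (auto simp: relational_extension_def map_le_def dom_def)

  define K where "K = (\<lambda>c \<rho>. {f \<in> domain_of H \<rho>. lrel H F \<rho> f (\<lambda>i. B' i c)})"
  \<comment> \<open>One choice treats both kinds of symbols: those of \<open>\<Sigma>\<close> as
    \<open>A\<close> prescribes, the added ones by the supremum of all elements related to their
    interpretations in the \<open>B' i\<close>.\<close>
  have "\<exists>u. \<forall>\<sigma>. \<Sigma>' c = Some \<sigma> \<longrightarrow> u \<in> domain_of H \<sigma> \<and> lrel H F \<sigma> u (\<lambda>i. B' i c) \<and>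
      (if c \<in> dom \<Sigma> then represents H A c \<sigma> u else is_lub H \<sigma> (K c \<sigma>) u)" for c
  proof (cases "\<Sigma>' c")
    case (Some \<sigma>)
    show ?thesis
    proof (cases "c \<in> dom \<Sigma>")
      case True
      then have \<sigma>: "\<Sigma> c = Some \<sigma>" using sub Some by fastforce
      then have fo: "fo_type \<sigma>" using assms(2) by (simp add: fo_signature_def)
      have r: "represents H A c \<sigma> (B' i c)" for i using B'(1) \<sigma> by (simp add: expansion_def)
      have "inds H = carrier A" using assms(8) by (simp add: expands_def)
      \<comment> \<open>The family is constant on symbols of \<open>\<Sigma>\<close>, so its value
        at the index \<open>{}\<close> stands for all.\<close>
      then have "B' i c = B' {} c" for i by (rule represents_unique[OF pre_frame _ fo r r])
      then have "lrel H F \<sigma> (B' {} c) (\<lambda>i. B' i c)" by (intro lrel_fo_type[OF fo]) simp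
      then show ?thesis using r[of "{}"] Some True by (auto simp: represents_def)
    next
      case False
      then have "rel_type \<sigma>" using assms(4) Some
        by (simp add: relational_extension_def domIff)
      then obtain u where u: "u \<in> domain_of H \<sigma>" "is_lub H \<sigma> (K c \<sigma>) u"
        using assms(7) unfolding complete_preframe_def K_def
        by (metis (no_types, lifting) mem_Collect_eq subsetI)
      \<comment> \<open>The supremum is thus itself a member of \<open>K c \<sigma>\<close>, the
        largest element related to the family.\<close>
      have "lrel H F \<sigma> u (\<lambda>i. B' i c)" by (rule lrel_is_lub[OF u(2)]) (simp add: K_def)
      then show ?thesis using u Some False by auto
    qed
  qed simp
  then obtain B where B: "\<And>c \<sigma>. \<Sigma>' c = Some \<sigma> \<Longrightarrow> B c \<in> domain_of H \<sigma> \<and>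
      lrel H F \<sigma> (B c) (\<lambda>i. B' i c) \<and>
      (if c \<in> dom \<Sigma> then represents H A c \<sigma> (B c) else is_lub H \<sigma> (K c \<sigma>) (B c))"
    by metis
  have str: "structure \<Sigma>' H B" using B by (simp add: structure_def)
  have "expansion \<Sigma> \<Sigma>' A H B" unfolding expansion_def
  proof (intro conjI allI impI str)
    fix c \<sigma> assume "\<Sigma> c = Some \<sigma>"
    then show "represents H A c \<sigma> (B c)" using B[OF sub, of c \<sigma>] by (auto split: if_splits)
  qed

  \<comment> \<open>A clause has finitely many literals, so the eventual truths given by
    \<open>lrel_den\<close> combine into one.\<close>
  have transfer: "\<forall>\<^sub>F i in F. \<forall>M\<in>set Ms. is_true (den \<Delta> \<Sigma>' H (B' i) M (\<alpha>' i))"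
    if Ms: "\<forall>M\<in>set Ms. atom \<Delta> \<Sigma>' M \<and> is_true (den \<Delta> \<Sigma>' H B M \<alpha>)"
      and \<alpha>: "valuation \<Delta> H \<alpha>" "\<And>i. valuation \<Delta> H (\<alpha>' i)"
        "\<And>x. lrel H F (\<Delta> x) (\<alpha> x) (\<lambda>i. \<alpha>' i x)" for Ms \<alpha> \<alpha>'
  proof (rule eventually_ball_finite)
    show "\<forall>M\<in>set Ms. \<forall>\<^sub>F i in F. is_true (den \<Delta> \<Sigma>' H (B' i) M (\<alpha>' i))"
    proof
      fix M assume M: "M \<in> set Ms"
      have "lrel H F \<o> (den \<Delta> \<Sigma>' H B M \<alpha>) (\<lambda>i. den \<Delta> \<Sigma>' H (B' i) M (\<alpha>' i))"
        by (rule lrel_den) (use B Ms M \<alpha> str str' in \<open>auto simp: atom_def\<close>)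
      then show "\<forall>\<^sub>F i in F. is_true (den \<Delta> \<Sigma>' H (B' i) M (\<alpha>' i))" using Ms M by simp
    qed
  qed simp

  have "models \<Delta> \<Sigma>' H B C" if C: "C \<in> \<Gamma>" for C
  proof (rule ccontr)
    assume "\<not> models \<Delta> \<Sigma>' H B C"
    then obtain \<alpha> where \<alpha>: "valuation \<Delta> H \<alpha>"
      and false: "\<And>L. L \<in> set C \<Longrightarrow> \<not> is_true (den \<Delta> \<Sigma>' H B L \<alpha>)"
      unfolding models_def by blast
    have true: "is_true (den \<Delta> \<Sigma>' H B M \<alpha>)" if "Neg M \<in> set C" for M
      using false[OF that] by (simp add: is_true_def)
    \<comment> \<open>\<open>\<alpha>\<close> need not be related to its own constant family, so the
      \<open>B' i\<close> are inspected at \<open>\<alpha>'\<close> instead.\<close>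
    obtain \<alpha>' where \<alpha>': "valuation \<Delta> H \<alpha>'" "\<And>x. lrel H F (\<Delta> x) (\<alpha> x) (\<lambda>i. \<alpha>' x)"
      by (rule ex_dominating_valuation[OF str \<alpha>, where F = F]) blast
    from assms(9) C consider "goal_clause \<Delta> \<Sigma>' C" | "definite_clause \<Delta> \<Sigma> \<Sigma>' C"
      unfolding hochc_def by blast
    then show False
    proof cases
      case 1
      then obtain Ms where Ms: "\<forall>M\<in>set Ms. atom \<Delta> \<Sigma>' M" "C = map Neg Ms"
        unfolding goal_clause_def by blast
      have "\<forall>M\<in>set Ms. atom \<Delta> \<Sigma>' M \<and> is_true (den \<Delta> \<Sigma>' H B M \<alpha>)"
        using true Ms by simp
      \<comment> \<open>Eventually \<open>B' i\<close> makes all atoms of the clause true under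
        \<open>\<alpha>'\<close> and yet satisfies the clause.\<close>
      from transfer[OF this \<alpha> \<alpha>'(1,2)] ev_models[OF C] have "\<forall>\<^sub>F i in F. False"
      proof eventually_elim
        case (elim i)
        then show ?case using \<alpha>'(1) Ms(2) by (auto simp: models_def is_true_def)
      qed
      \<comment> \<open>\<open>F\<close> is a proper filter, so a contradiction cannot hold
        eventually.\<close>
      then show False by (simp add: F_def)
    next
      case 2
      then obtain Ms R xs where Ms: "\<forall>M\<in>set Ms. atom \<Delta> \<Sigma>' M"
        and R: "R \<notin> dom \<Sigma>" and xs: "distinct xs"
        and ty: "typing \<Delta> \<Sigma>' (foldl App (Sym R) (map Var xs)) \<o>"
        and C_eq: "C = map Neg Ms @ [foldl App (Sym R) (map Var xs)]"
        unfolding definite_clause_def goal_clause_def by blast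
      define \<rho> where "\<rho> = foldr (\<^bold>\<rightarrow>) (map \<Delta> xs) \<o>"
      have "typing \<Delta> \<Sigma>' (Sym R) \<rho>" using typing_foldl_App[OF ty] by (simp add: \<rho>_def)
      then have \<rho>: "\<Sigma>' R = Some \<rho>" by (auto elim: typing.cases)
      obtain z where z: "\<Delta> z = \<o>" using ex_var[of \<o>] by (auto intro: arg_type_rel_type.intros)
      have body: "typing \<Delta> \<Sigma>' (conjunction z Ms) \<o>" "positive_existential (conjunction z Ms)"
        and den_body: "\<And>\<beta>. valuation \<Delta> H \<beta> \<Longrightarrow> den \<Delta> \<Sigma>' H B (conjunction z Ms) \<beta>
            = Bool (\<forall>M\<in>set Ms. is_true (den \<Delta> \<Sigma>' H B M \<beta>))"
        using conjunction[OF z, of Ms] Ms str by blast+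
      \<comment> \<open>The body as a relation in the arguments of the head, the other variables
        being fixed by \<open>\<alpha>\<close>.\<close>
      define f where "f = den \<Delta> \<Sigma>' H B (foldr Lam xs (conjunction z Ms)) \<alpha>"
      have "f \<in> domain_of H \<rho>" unfolding f_def \<rho>_def
        by (rule den_foldr_Lam_in_domain[OF str \<alpha> body]) (simp add: den_body[OF \<alpha>])
      moreover have "lrel H F \<rho> f (\<lambda>i. B' i R)" unfolding f_def \<rho>_def
      proof (rule lrel_foldr_Lam[OF str body xs \<alpha> \<alpha>'(1,2)])
        fix \<beta> \<beta>'
        assume \<beta>: "valuation \<Delta> H \<beta>" "\<And>i. valuation \<Delta> H (\<beta>' i)"
          "\<And>x. lrel H F (\<Delta> x) (\<beta> x) (\<lambda>i. \<beta>' i x)"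
          and "is_true (den \<Delta> \<Sigma>' H B (conjunction z Ms) \<beta>)"
        then have "\<forall>M\<in>set Ms. atom \<Delta> \<Sigma>' M \<and> is_true (den \<Delta> \<Sigma>' H B M \<beta>)"
          using den_body Ms by (simp add: is_true_def)
        \<comment> \<open>Eventually the body is true in \<open>B' i\<close> and the clause holds
          there, which forces the head.\<close>
        from transfer[OF this \<beta>] ev_models[OF C]
        show "\<forall>\<^sub>F i in F. is_true (foldl (vapp H) (B' i R) (map (\<beta>' i) xs))"
        proof eventually_elim
          case (elim i)
          then obtain L where "L \<in> set C" "is_true (den \<Delta> \<Sigma>' H (B' i) L (\<beta>' i))"
            using \<beta>(2) unfolding models_def by blast
          then show ?case using elim(1) C_eq by (auto simp: den_foldl_App_Var is_true_def)
        qed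
      qed
      ultimately have "f \<in> K R \<rho>" by (simp add: K_def)
      moreover have "is_lub H \<rho> (K R \<rho>) (B R)" using B[OF \<rho>] R by simp
      moreover have "list_all2 (\<lambda>a t. a \<in> domain_of H t) (map \<alpha> xs) (map \<Delta> xs)"
        using \<alpha> by (simp add: list_all2_conv_all_nth valuation_def)
      \<comment> \<open>The clause fails at \<open>\<alpha>\<close>, so all atoms of its body are
        true there; as \<open>f\<close> lies below \<open>B R\<close>, the head is then true as
        well, although it was assumed false.\<close>
      moreover have "is_true (foldl (vapp H) f (map \<alpha> xs))"
        unfolding f_def foldl_vapp_foldr_Lam[OF str \<alpha> body] den_body[OF \<alpha>]
        using true C_eq by (simp add: is_true_def)
      ultimately have "is_true (foldl (vapp H) (B R) (map \<alpha> xs))"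
        unfolding \<rho>_def using is_lub_upper by blast
      then show False
        using false[of "foldl App (Sym R) (map Var xs)"] C_eq by (simp add: den_foldl_App_Var)
    qed
  qed
  with \<open>expansion \<Sigma> \<Sigma>' A H B\<close> have "satisfiable \<Delta> \<Sigma> \<Sigma>' A H \<Gamma>" by (auto simp: satisfiable_def)
  with assms(10) show False ..
qed

end
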